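(* For every real $r\in(1/4,1)$ there exists a constant $c_r\in\mathbb{N}$ (depending only on $r$) such that for every integer $d\geq 2$, \[N(r,d)\leq c_r.\] In particular, $c_r$ can be taken to be \[c_r=\left\lfloor \frac{1}{r-1/4}\right\rfloor+1 .\]
   Context: For an integer $d\ge 2$, let $\mathscr{B}_d$ be the family of all open axis-parallel boxes $B=I_1\times\cdots\times I_d\subseteq[0,1]^d$, where each $I_i$ is an open interval; the volume is $\operatorname{vol}(B)=|I_1|\cdots|I_d|$, where $|I_i|$ is the length of $I_i$. For a finite set $T\subset[0,1]^d$, the dispersion of $T$ is \[\operatorname{disp}(T)=\sup_{B\in\mathscr{B}_d,\ B\cap T=\emptyset}\operatorname{vol}(B).\] The minimal dispersion is \[\operatorname{disp}^*(n,d)=\inf_{T\subset[0,1]^d,\ |T|=n}\operatorname{disp}(T),\] and for $r\in(0,1)$ its inverse function is \[N(r,d)=\min\{n\in\mathbb{N}:\operatorname{disp}^*(n,d)\leq r\}.\] *)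

theory Defs
  imports "HOL-Analysis.Analysis" "HOL-Library.Extended_Nat" "HOL-Library.FuncSet"
begin

text \<open>
  The dimension is a natural number quantified inside the theorem, so points are functions
  \<open>nat \<Rightarrow> real\<close> indexed by \<open>{..<d}\<close>.  They are taken extensional (\<open>\<rightarrow>\<^sub>E\<close>), so that
  \<open>card\<close> counts points of $[0,1]^d$ exactly once.
\<close>

definition unit_cube :: "nat \<Rightarrow> (nat \<Rightarrow> real) set" where
  "unit_cube d = {..<d} \<rightarrow>\<^sub>E {0..1}"

definition open_box :: "nat \<Rightarrow> (nat \<Rightarrow> real) \<Rightarrow> (nat \<Rightarrow> real) \<Rightarrow> (nat \<Rightarrow> real) set" where
  "open_box d a b = (\<Pi>\<^sub>E i\<in>{..<d}. {a i<..<b i})"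

text \<open>
  The boxes are represented by their endpoints.  Requiring \<open>a i < b i\<close> makes every factor a
  nonempty interval of length \<open>b i - a i\<close>; empty boxes have volume 0 and would not affect the
  supremum, which for finite \<open>T\<close> and \<open>d \<ge> 1\<close> is over a nonempty set bounded by 1.
\<close>

definition dispersion :: "nat \<Rightarrow> (nat \<Rightarrow> real) set \<Rightarrow> real" where
  "dispersion d T = Sup {(\<Prod>i<d. b i - a i) | a b.
     (\<forall>i<d. a i < b i) \<and> open_box d a b \<subseteq> unit_cube d \<and> open_box d a b \<inter> T = {}}"

definition min_dispersion :: "nat \<Rightarrow> nat \<Rightarrow> real" where
  "min_dispersion n d =
     Inf {dispersion d T | T. T \<subseteq> unit_cube d \<and> finite T \<and> card T = n}"

text \<open>
  The infimum in \<open>enat\<close> of a nonempty set is its minimum, while the infimum of the empty set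
  is \<open>\<infinity>\<close>.  A finite upper bound on \<open>inverse_dispersion r d\<close> therefore includes the claim
  that the minimum exists.
\<close>

definition inverse_dispersion :: "real \<Rightarrow> nat \<Rightarrow> enat" where
  "inverse_dispersion r d = Inf (enat ` {n. min_dispersion n d \<le> r})"

end

(* Place n equally spaced points on the main diagonal.  Let the i-th side of an empty box have
   the largest left endpoint a_i and the j-th side the smallest right endpoint b_j.  The interval
   (a_i, b_j), possibly void, avoids the grid, so b_j <= a_i + h with h = 1/(n+1).  If i = j, this
   bounds one side by h; otherwise the volume is at most (1 - a_i) b_j <= ((1 + h)/2)^2
   <= 1/4 + h. *)
theory Submission
  imports Defs
begin

text \<open>Indices run from 1 to \<open>n\<close>, so both corners of the diagonal are left out and
  \<open>n\<close> points cut it into \<open>n + 1\<close> equal gaps. The restriction to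
  \<open>{..<d}\<close> makes the points extensional, as \<open>unit_cube\<close> demands.\<close>

definition diagonal_points :: "nat \<Rightarrow> nat \<Rightarrow> (nat \<Rightarrow> real) set" where
  "diagonal_points d n = (\<lambda>k. \<lambda>i\<in>{..<d}. real k / (real n + 1)) ` {1..n}"

lemma diagonal_points_subset: "diagonal_points d n \<subseteq> unit_cube d"
  unfolding diagonal_points_def unit_cube_def by (auto intro!: restrict_PiE_iff[THEN iffD2])

lemma finite_diagonal_points: "finite (diagonal_points d n)"
  unfolding diagonal_points_def by simp

lemma card_diagonal_points:
  assumes "d \<ge> 1"
  shows "card (diagonal_points d n) = n"
proof -
  have "inj_on (\<lambda>k. \<lambda>i\<in>{..<d}. real k / (real n + 1)) {1..n}"
  proof (rule inj_onI)
    fix k l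
    assume "(\<lambda>i\<in>{..<d}. real k / (real n + 1)) = (\<lambda>i\<in>{..<d}. real l / (real n + 1))"
    \<comment> \<open>Coordinate 0 exists because \<open>d \<ge> 1\<close>; in dimension 0 all the
      points would coincide.\<close>
    from fun_cong[OF this, of 0] show "k = l"
      using assms by (simp add: field_simps)
  qed
  then show ?thesis
    unfolding diagonal_points_def by (simp add: card_image)
qed

text \<open>Otherwise the first grid point beyond \<open>a\<close> would lie before
  \<open>b\<close>. The interval may be void: \<open>a < b\<close> is not assumed, since the
  endpoints will come from different sides of a box.\<close>

lemma grid_free_interval_length:
  fixes a b :: real
  assumes "0 \<le> a" "b \<le> 1"
    and free: "\<And>k::nat. k \<in> {1..n} \<Longrightarrow> \<not> (a < real k / (real n + 1) \<and> real k / (real n + 1) < b)"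
  shows "b \<le> a + 1 / (real n + 1)"
proof (rule ccontr)
  assume "\<not> ?thesis"
  then have gap: "a * (real n + 1) + 1 < b * (real n + 1)"
    by (simp add: field_simps)
  \<comment> \<open>The least integer strictly above \<open>a * (real n + 1)\<close>; a ceiling
    would fail to be strict when that product is an integer.\<close>
  define k where "k = nat (\<lfloor>a * (real n + 1)\<rfloor> + 1)"
  have "0 \<le> a * (real n + 1)"
    using assms(1) by simp
  then have k: "a * (real n + 1) < real k" "real k \<le> a * (real n + 1) + 1" "1 \<le> k"
    unfolding k_def by linarith+
  have "b * (real n + 1) \<le> real n + 1"
    using mult_right_mono[OF assms(2), of "real n + 1"] by simp
  with gap k have "real k < real n + 1"
    by linarith
  with k have "k \<in> {1..n}"
    by auto
  moreover have "a < real k / (real n + 1)" "real k / (real n + 1) < b"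
    using gap k by (simp_all add: field_simps)
  ultimately show False
    using free by blast
qed

lemma open_box_subset_unit_cubeD:
  assumes pos: "\<forall>i<d. a i < b i" and sub: "open_box d a b \<subseteq> unit_cube d" and "i < d"
  shows "0 \<le> a i" "b i \<le> 1"
proof -
  have "{a i<..<b i} \<subseteq> {0..1}"
  proof
    fix x assume x: "x \<in> {a i<..<b i}"
    \<comment> \<open>Containment is known only for whole boxes, so \<open>x\<close> is completed to
      a point of the box by the midpoints of the other sides.\<close>
    define p where "p = (\<lambda>j\<in>{..<d}. if j = i then x else (a j + b j) / 2)"
    have "p \<in> open_box d a b"
      using x pos unfolding p_def open_box_def by (auto simp: field_simps)
    then have "p i \<in> {0..1}"
      using sub \<open>i < d\<close> unfolding unit_cube_def by blast
    then show "x \<in> {0..1}"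
      using \<open>i < d\<close> by (simp add: p_def)
  qed
  then show "0 \<le> a i" "b i \<le> 1"
    using pos \<open>i < d\<close> by (simp_all add: greaterThanLessThan_subseteq_atLeastAtMost_iff)
qed

lemma box_volume_avoiding_diagonal_points:
  assumes "d \<ge> 1" and pos: "\<forall>i<d. a i < b i"
    and sub: "open_box d a b \<subseteq> unit_cube d"
    and avoid: "open_box d a b \<inter> diagonal_points d n = {}"
  shows "(\<Prod>i<d. b i - a i) \<le> 1 / 4 + 1 / (real n + 1)"
proof -
  define h where "h = 1 / (real n + 1)"
  have h: "0 < h" "h \<le> 1"
    unfolding h_def by simp_all
  have bounds: "0 \<le> a i" "b i \<le> 1" "a i < b i" if "i < d" for i
    using open_box_subset_unit_cubeD[OF pos sub that] pos that by auto
  \<comment> \<open>This lets all sides other than \<open>i\<close> and \<open>j\<close> be dropped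
    from the volume, which makes the bound independent of \<open>d\<close>.\<close>
  have rest: "(\<Prod>k\<in>A. b k - a k) \<le> 1" if "A \<subseteq> {..<d}" for A
  proof (rule prod_le_1)
    fix k assume "k \<in> A"
    with that have "k < d" by auto
    from bounds[OF this] show "0 \<le> b k - a k \<and> b k - a k \<le> 1" by linarith
  qed
  have nonempty: "{..<d} \<noteq> {}"
    using \<open>d \<ge> 1\<close> by (auto simp: lessThan_empty_iff)
  obtain i where i: "i < d" and imax: "\<And>k. k < d \<Longrightarrow> a k \<le> a i"
    using Max_in[of "a ` {..<d}"] Max_ge[of "a ` {..<d}"] nonempty by fastforce
  obtain j where j: "j < d" and jmin: "\<And>k. k < d \<Longrightarrow> b j \<le> b k"
    using Min_in[of "b ` {..<d}"] Min_le[of "b ` {..<d}"] nonempty by fastforce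
  have "b j \<le> a i + 1 / (real n + 1)"
  proof (rule grid_free_interval_length)
    fix k assume k: "k \<in> {1..n}"
    show "\<not> (a i < real k / (real n + 1) \<and> real k / (real n + 1) < b j)"
    proof
      assume in_gap: "a i < real k / (real n + 1) \<and> real k / (real n + 1) < b j"
      \<comment> \<open>By the extremal choice of \<open>i\<close> and \<open>j\<close>, the
        interval from \<open>a i\<close> to \<open>b j\<close> is the intersection of all sides, so
        a grid value in it gives a diagonal point in the box.\<close>
      then have "real k / (real n + 1) \<in> {a l<..<b l}" if "l < d" for l
        using imax[OF that] jmin[OF that] by simp
      then have "(\<lambda>i\<in>{..<d}. real k / (real n + 1)) \<in> open_box d a b"
        unfolding open_box_def restrict_PiE_iff by blast
      moreover have "(\<lambda>i\<in>{..<d}. real k / (real n + 1)) \<in> diagonal_points d n"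
        using k unfolding diagonal_points_def by blast
      ultimately show False
        using avoid by blast
    qed
  qed (use bounds i j in auto)
  then have gap: "b j \<le> a i + h"
    unfolding h_def .
  have split_i: "(\<Prod>k<d. b k - a k) = (b i - a i) * (\<Prod>k\<in>{..<d} - {i}. b k - a k)"
    using i by (intro prod.remove) auto
  have "(\<Prod>k<d. b k - a k) \<le> 1 / 4 + h"
  proof (cases "i = j")
    case True
    have "(\<Prod>k<d. b k - a k) \<le> b i - a i"
      using split_i mult_left_le[OF rest[of "{..<d} - {i}"], of "b i - a i"] bounds[OF i]
      by auto
    with gap h show ?thesis unfolding True by linarith
  next
    case False
    have "(\<Prod>k\<in>{..<d} - {i}. b k - a k)
        = (b j - a j) * (\<Prod>k\<in>{..<d} - {i} - {j}. b k - a k)"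
      using j False by (intro prod.remove) auto
    also have "\<dots> \<le> b j - a j"
      using mult_left_le[OF rest[of "{..<d} - {i} - {j}"], of "b j - a j"] bounds[OF j]
      by auto
    finally have "(\<Prod>k<d. b k - a k) \<le> (b i - a i) * (b j - a j)"
      using split_i bounds[OF i] by (simp add: mult_left_mono)
    \<comment> \<open>Uses \<open>b i \<le> 1\<close>, \<open>0 \<le> a j\<close> and
      \<open>gap\<close>; only \<open>a i\<close> remains, and completing the square removes
      it.\<close>
    also have "\<dots> \<le> (1 - a i) * (a i + h)"
      using bounds[OF i] bounds[OF j] gap by (intro mult_mono) auto
    also have "\<dots> = ((1 + h) / 2)\<^sup>2 - (a i - (1 - h) / 2)\<^sup>2"
      by (simp add: power2_eq_square field_simps)
    also have "\<dots> \<le> ((1 + h) / 2)\<^sup>2"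
      by simp
    also have "\<dots> = 1 / 4 + h / 2 + h * h / 4"
      by (simp add: power2_eq_square field_simps)
    \<comment> \<open>Since \<open>h \<le> 1\<close>, the quadratic term is at most
      \<open>h / 4\<close>.\<close>
    also have "\<dots> \<le> 1 / 4 + h"
      using mult_left_le[of h h] h by linarith
    finally show ?thesis .
  qed
  then show ?thesis
    unfolding h_def .
qed

lemma dispersion_diagonal_points:
  assumes "d \<ge> 1"
  shows "dispersion d (diagonal_points d n) \<le> 1 / 4 + 1 / (real n + 1)"
  unfolding dispersion_def
proof (rule cSup_least)
  \<comment> \<open>The supremum is bounded by its members only if there are any. The corner cube
    with these right endpoints ends where the first diagonal point begins, so it is empty.\<close>
  define b where "b = (\<lambda>i::nat. 1 / (real n + 1))"
  have "{0<..<1 / (real n + 1)} \<subseteq> {0..1}"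
    using divide_le_eq_1_pos[of "real n + 1" 1] by (auto simp del: divide_le_eq_1_pos)
  then have "open_box d (\<lambda>_. 0) b \<subseteq> unit_cube d"
    unfolding open_box_def unit_cube_def b_def
    by (rule PiE_mono)
  moreover have "p \<notin> open_box d (\<lambda>_. 0) b" if p: "p \<in> diagonal_points d n" for p
  proof
    assume "p \<in> open_box d (\<lambda>_. 0) b"
    then have "p 0 < 1 / (real n + 1)"
      using assms unfolding open_box_def b_def by (auto simp: PiE_iff)
    moreover obtain k where "k \<in> {1..n}" "p = (\<lambda>i\<in>{..<d}. real k / (real n + 1))"
      using p unfolding diagonal_points_def by blast
    ultimately show False
      using assms by (simp add: divide_less_cancel)
  qed
  moreover have "\<forall>i<d. 0 < b i"
    by (simp add: b_def)
  ultimately have "(\<Prod>i<d. b i - 0) \<in> {(\<Prod>i<d. b i - a i) | a b. (\<forall>i<d. a i < b i) \<and>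
      open_box d a b \<subseteq> unit_cube d \<and> open_box d a b \<inter> diagonal_points d n = {}}"
    by (intro CollectI exI[of _ "\<lambda>_. 0"] exI[of _ b] conjI refl) auto
  then show "{(\<Prod>i<d. b i - a i) | a b. (\<forall>i<d. a i < b i) \<and>
      open_box d a b \<subseteq> unit_cube d \<and> open_box d a b \<inter> diagonal_points d n = {}} \<noteq> {}"
    by (metis empty_iff)
qed (use box_volume_avoiding_diagonal_points[OF assms] in blast)

text \<open>
  The term \<open>Sup {}\<close>, an unspecified real, spares us exhibiting an empty box for arbitrary \<open>T\<close>.
\<close>

lemma dispersion_lower_bound: "min 0 (Sup {}) \<le> dispersion d T"
proof -
  define S where "S = {(\<Prod>i<d. b i - a i) | a b. (\<forall>i<d. a i < b i) \<and>
      open_box d a b \<subseteq> unit_cube d \<and> open_box d a b \<inter> T = {}}"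
  have S: "0 \<le> x \<and> x \<le> 1" if x: "x \<in> S" for x
  proof -
    obtain a b where x_eq: "x = (\<Prod>i<d. b i - a i)" and pos: "\<forall>i<d. a i < b i"
      and sub: "open_box d a b \<subseteq> unit_cube d"
      using x unfolding S_def by blast
    have "0 \<le> b i - a i \<and> b i - a i \<le> 1" if "i < d" for i
      using open_box_subset_unit_cubeD[OF pos sub that] pos that by fastforce
    then show ?thesis
      unfolding x_eq by (auto intro!: prod_nonneg prod_le_1)
  qed
  have "min 0 (Sup {}) \<le> Sup S"
  proof (cases "S = {}")
    case False
    then obtain x where "x \<in> S" by blast
    then have "0 \<le> Sup S"
      using S by (intro cSup_upper2[of x] bdd_aboveI[of _ 1]) auto
    then show ?thesis by simp
  qed simp
  then show ?thesis
    unfolding dispersion_def S_def .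
qed

lemma min_dispersion_le:
  assumes "d \<ge> 1"
  shows "min_dispersion n d \<le> 1 / 4 + 1 / (real n + 1)"
proof -
  have "min_dispersion n d \<le> dispersion d (diagonal_points d n)"
    unfolding min_dispersion_def
  proof (rule cInf_lower)
    show "dispersion d (diagonal_points d n)
        \<in> {dispersion d T | T. T \<subseteq> unit_cube d \<and> finite T \<and> card T = n}"
      using diagonal_points_subset finite_diagonal_points card_diagonal_points[OF assms] by blast
    \<comment> \<open>A real infimum lies below its members only for a set bounded below, so a bound
      uniform in \<open>T\<close> is required.\<close>
    show "bdd_below {dispersion d T | T. T \<subseteq> unit_cube d \<and> finite T \<and> card T = n}"
      using dispersion_lower_bound by (intro bdd_belowI[of _ "min 0 (Sup {})"]) blast
  qed
  also have "\<dots> \<le> 1 / 4 + 1 / (real n + 1)"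
    using dispersion_diagonal_points[OF assms] .
  finally show ?thesis .
qed

theorem theorem1:
  fixes r :: real
  assumes "1/4 < r" and "r < 1"
  shows "(\<exists>c::nat. \<forall>d::nat. d \<ge> 2 \<longrightarrow> inverse_dispersion r d \<le> enat c) \<and>
         (\<forall>d::nat. d \<ge> 2 \<longrightarrow>
            inverse_dispersion r d \<le> enat (nat \<lfloor>1 / (r - 1/4)\<rfloor> + 1))"
proof -
  define n where "n = nat \<lfloor>1 / (r - 1/4)\<rfloor> + 1"
  \<comment> \<open>A number is less than its floor plus one, so even \<open>n\<close> exceeds the
    left side. The choice of \<open>n\<close> involves only \<open>r\<close>, and the bound on
    \<open>min_dispersion\<close> is the same for all \<open>d\<close>.\<close>
  have "1 / (r - 1/4) \<le> real n + 1"
    unfolding n_def by linarith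
  then have "1 / (real n + 1) \<le> r - 1/4"
    using assms(1) by (simp add: field_simps)
  then have "min_dispersion n d \<le> r" if "d \<ge> 2" for d
    using min_dispersion_le[of d n] that by linarith
  \<comment> \<open>The number \<open>n\<close> itself belongs to the set whose infimum is
    taken.\<close>
  then have "inverse_dispersion r d \<le> enat n" if "d \<ge> 2" for d
    unfolding inverse_dispersion_def using that by (intro Inf_lower) auto
  then show ?thesis
    unfolding n_def by blast
qed

end
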